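(* Let $\mathbb{D}=\{z\in\mathbb{C}:|z|<1\}$ and let $f=h+\overline{g}$ be a sense-preserving univalent harmonic mapping of $\mathbb{D}$ with $h(z)=z+\sum_{n=2}^\infty a_nz^n$ and $g(z)=\sum_{n=2}^\infty b_nz^n$ (so $f\in\mathcal{S}^0_H$), which is stable convex, i.e. $h+\mu\overline{g}$ is univalent and convex in $\mathbb{D}$ for every $|\mu|=1$. Let $m\in\mathbb{N}$, $\omega_m\in\mathcal{B}_m$ and $\lambda\in[0,1]$. Then $$\big|(1-\lambda)f(\omega_m(z))+\lambda Df(\omega_m(z))\big|\le d\big(f(0),\partial f(\mathbb{D})\big)\quad\text{and}\quad\big|(1-\lambda)f(\omega_m(z))+\lambda \mathscr{D}f(\omega_m(z))\big|\le d\big(f(0),\partial f(\mathbb{D})\big)$$ both hold for $|z|=r\le r_{6,m}$, where $r_{6,m}$ is the unique root in $(0,1)$ of $$\frac{(1-\lambda)r^m}{1-r^m}+\frac{\lambda r^m}{(1-r^m)^2}-\frac12=0.$$ The radius $r_{6,m}$ is best possible.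
   Context: For $n\in\mathbb{N}$, $\mathcal{B}_n$ denotes the set of analytic functions $\omega:\mathbb{D}\to\mathbb{C}$ with $|\omega(z)|\le1$ in $\mathbb{D}$, $\omega(0)=\omega'(0)=\cdots=\omega^{(n-1)}(0)=0$ and $\omega^{(n)}(0)\neq0$. For a harmonic $f$, $Df=zf_z-\overline{z}f_{\overline{z}}$ and $\mathscr{D}f=zf_z+\overline{z}f_{\overline{z}}$, and $Df(\omega_m(z))$ means $(Df)(\omega_m(z))$ (similarly for $\mathscr{D}$). $d(f(0),\partial f(\mathbb{D}))$ is the Euclidean distance from $f(0)$ to the boundary of $f(\mathbb{D})$. "Best possible" means that for every $r>r_{6,m}$ there exist such $f,\omega_m$ and $z$ with $|z|=r$ for which the inequality fails. *)

theory Defs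
  imports "HOL-Analysis.Analysis"
begin

abbreviation unit_disk :: "complex set" where
  "unit_disk \<equiv> ball 0 1"

definition harm :: "(complex \<Rightarrow> complex) \<Rightarrow> (complex \<Rightarrow> complex) \<Rightarrow> complex \<Rightarrow> complex" where
  "harm h g = (\<lambda>z. h z + cnj (g z))"

text \<open>f in S_H^0: h, g holomorphic in the disk, h(0)=0, h'(0)=1, g(0)=g'(0)=0,
  f univalent and sense-preserving (Jacobian |h'|^2-|g'|^2 > 0).\<close>
definition in_SH0 :: "(complex \<Rightarrow> complex) \<Rightarrow> (complex \<Rightarrow> complex) \<Rightarrow> bool" where
  "in_SH0 h g \<longleftrightarrow> h holomorphic_on unit_disk \<and> g holomorphic_on unit_disk \<and>
     h 0 = 0 \<and> deriv h 0 = 1 \<and> g 0 = 0 \<and> deriv g 0 = 0 \<and>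
     inj_on (harm h g) unit_disk \<and>
     (\<forall>z\<in>unit_disk. norm (deriv g z) < norm (deriv h z))"

definition stable_convex :: "(complex \<Rightarrow> complex) \<Rightarrow> (complex \<Rightarrow> complex) \<Rightarrow> bool" where
  "stable_convex h g \<longleftrightarrow> (\<forall>\<mu>::complex. norm \<mu> = 1 \<longrightarrow>
     inj_on (\<lambda>z. h z + \<mu> * cnj (g z)) unit_disk \<and>
     convex ((\<lambda>z. h z + \<mu> * cnj (g z)) ` unit_disk))"

definition B_class :: "nat \<Rightarrow> (complex \<Rightarrow> complex) set" where
  "B_class n = {\<omega>. \<omega> holomorphic_on unit_disk \<and> (\<forall>z\<in>unit_disk. norm (\<omega> z) \<le> 1) \<and>
     (\<forall>k<n. (deriv ^^ k) \<omega> 0 = 0) \<and> (deriv ^^ n) \<omega> 0 \<noteq> 0}"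

text \<open>Df = z f_z - conj z f_{conj z} and \<D>f = z f_z + conj z f_{conj z}, with
  f_z = h', f_{conj z} = conj g'.\<close>
definition Dop :: "(complex \<Rightarrow> complex) \<Rightarrow> (complex \<Rightarrow> complex) \<Rightarrow> complex \<Rightarrow> complex" where
  "Dop h g = (\<lambda>z. z * deriv h z - cnj z * cnj (deriv g z))"

definition Dop2 :: "(complex \<Rightarrow> complex) \<Rightarrow> (complex \<Rightarrow> complex) \<Rightarrow> complex \<Rightarrow> complex" where
  "Dop2 h g = (\<lambda>z. z * deriv h z + cnj z * cnj (deriv g z))"

definition dist_bdry :: "(complex \<Rightarrow> complex) \<Rightarrow> real" where
  "dist_bdry f = infdist (f 0) (frontier (f ` unit_disk))"

definition root_eq :: "real \<Rightarrow> nat \<Rightarrow> real \<Rightarrow> real" where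
  "root_eq lam m r = (1 - lam) * r ^ m / (1 - r ^ m) + lam * r ^ m / (1 - r ^ m)^2 - 1/2"

end

theory Submission
  imports Defs "HOL-Complex_Analysis.Complex_Analysis"
begin

text \<open>Stability forces \<open>|h z - h w| \<noteq> |g z - g w|\<close> for \<open>z \<noteq> w\<close>, so every \<open>h + \<nu> g\<close> with \<open>|\<nu>| = 1\<close> is
  univalent, and a shear argument shows that its image is convex. The coefficients of a normalised
  convex univalent function are bounded by 1; choosing \<open>\<nu>\<close> so that the two terms align gives
  \<open>|h| + |g| \<le> r / (1 - r)\<close> and \<open>|h'| + |g'| \<le> 1 / (1 - r)\<^sup>2\<close> on \<open>|z| = r\<close>. A supporting half-plane of the
  image of \<open>f\<close> also contains the image of some \<open>h + \<nu> g\<close>, so by the Schwarz lemma its edge is at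
  distance at least 1/2 from the origin. Together with \<open>|\<omega> z| \<le> |z|\<^sup>m\<close> this gives the radius, and
  \<open>h = z / (1 - z)\<close>, \<open>g = 0\<close>, \<open>\<omega> = z\<^sup>m\<close> shows that it is best possible.\<close>

subsection \<open>Convex univalent functions\<close>

text \<open>Termwise division by \<open>z ^ n\<close> keeps the series convergent, so the quotient
  is analytic across the origin. This serves both the maps in \<open>B_class\<close> and the
  averages over roots of unity.\<close>

lemma power_series_factor:
  fixes a :: "nat \<Rightarrow> complex"
  assumes sums: "\<And>z. z \<in> unit_disk \<Longrightarrow> (\<lambda>j. a j * z ^ j) sums f z"
    and zero: "\<And>j. j < n \<Longrightarrow> a j = 0"
  obtains V where "V holomorphic_on unit_disk" "\<And>z. z \<in> unit_disk \<Longrightarrow> f z = z ^ n * V z" "V 0 = a n"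
proof -
  have tail: "(\<lambda>j. a (j + n) * z ^ (j + n)) sums f z" if "z \<in> unit_disk" for z
    using sums_split_initial_segment[OF sums[OF that], of n] zero by simp
  have smm: "summable (\<lambda>j. a (j + n) * z ^ j)" if z: "z \<in> unit_disk" for z
  proof (cases "z = 0")
    case True
    then show ?thesis using summable_finite[of "{0}" "\<lambda>j. a (j + n) * z ^ j"] by (auto simp: power_0_left)
  next
    case False
    have "summable (\<lambda>j. inverse (z ^ n) * (a (j + n) * z ^ (j + n)))"
      using tail[OF z] by (intro summable_mult) (rule sums_summable)
    then show ?thesis using False by (simp add: power_add field_simps)
  qed
  define V where "V z = (\<Sum>j. a (j + n) * z ^ j)" for z
  have V: "(\<lambda>j. a (j + n) * z ^ j) sums V z" if "z \<in> unit_disk" for z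
    unfolding V_def using smm[OF that] by (rule summable_sums)
  show thesis
  proof
    show "V holomorphic_on unit_disk"
      by (rule power_series_holomorphic[of 0 1 "\<lambda>j. a (j + n)" V]) (use V in simp)
    show "f z = z ^ n * V z" if "z \<in> unit_disk" for z
    proof (rule sums_unique2[OF tail[OF that]])
      show "(\<lambda>j. a (j + n) * z ^ (j + n)) sums (z ^ n * V z)"
        using sums_mult[OF V[OF that], of "z ^ n"] by (simp add: power_add mult_ac)
    qed
    show "V 0 = a n"
      unfolding V_def using powser_zero[of "\<lambda>j. a (j + n)"] by simp
  qed
qed

text \<open>The maximum principle on the circle of radius \<open>s\<close> gives the bound
  \<open>1 / s ^ n\<close>; then \<open>s\<close> tends to 1.\<close>

lemma Schwarz_quotient_le:
  assumes V: "V holomorphic_on unit_disk"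
    and bd: "\<And>z. z \<in> unit_disk \<Longrightarrow> norm (z ^ n * V z) \<le> 1"
    and z: "z \<in> unit_disk"
  shows "norm (V z) \<le> 1"
proof -
  have z1: "norm z < 1" using z by simp
  have *: "norm (V z) * s ^ n \<le> 1" if s: "norm z < s" "s < 1" for s :: real
  proof -
    have s0: "0 < s" using s norm_ge_zero[of z] by linarith
    have sub: "cball 0 s \<subseteq> unit_disk" using s by auto
    have "norm (V z) \<le> 1 / s ^ n"
    proof (rule maximum_modulus_frontier[of V "ball 0 s"])
      show "V holomorphic_on interior (ball 0 s)"
        using V by (rule holomorphic_on_subset) (use sub in auto)
      show "continuous_on (closure (ball 0 s)) V"
        using s0 holomorphic_on_imp_continuous_on[OF V] sub by (auto intro: continuous_on_subset)
      show "norm (V w) \<le> 1 / s ^ n" if "w \<in> frontier (ball 0 s)" for w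
      proof -
        have w: "norm w = s" using that s0 by simp
        then have "norm (w ^ n * V w) \<le> 1" using s by (intro bd) simp
        then show ?thesis using w s0 by (simp add: norm_mult norm_power field_simps)
      qed
    qed (use s in auto)
    then show ?thesis using s0 by (simp add: field_simps)
  qed
  have "((\<lambda>s. norm (V z) * s ^ n) \<longlongrightarrow> norm (V z) * 1 ^ n) (at_left 1)"
    by (intro tendsto_intros)
  moreover have "\<forall>\<^sub>F s in at_left 1. norm (V z) * s ^ n \<le> 1"
    using eventually_at_left_real[OF z1] by eventually_elim (auto intro: *)
  ultimately show ?thesis
    using tendsto_upperbound[of _ _ "at_left (1::real)" 1] by simp
qed

lemma B_class_bound:
  assumes "\<omega> \<in> B_class m" "z \<in> unit_disk"
  shows "norm (\<omega> z) \<le> norm z ^ m"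
proof -
  have hol: "\<omega> holomorphic_on unit_disk" and le: "\<And>z. z \<in> unit_disk \<Longrightarrow> norm (\<omega> z) \<le> 1"
    and zero: "\<And>k. k < m \<Longrightarrow> (deriv ^^ k) \<omega> 0 = 0"
    using assms(1) unfolding B_class_def by auto
  obtain V where V: "V holomorphic_on unit_disk" "\<And>z. z \<in> unit_disk \<Longrightarrow> \<omega> z = z ^ m * V z"
  proof (rule power_series_factor[of "\<lambda>n. (deriv ^^ n) \<omega> 0 / fact n" \<omega> m])
    show "(\<lambda>n. (deriv ^^ n) \<omega> 0 / fact n * z ^ n) sums \<omega> z" if "z \<in> unit_disk" for z
      using holomorphic_power_series[OF hol that] by simp
  qed (use zero in auto)
  have "norm (V z) \<le> 1"
    by (rule Schwarz_quotient_le[OF V(1) _ assms(2)]) (use le V(2) in force)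
  then show ?thesis
    using V(2)[OF assms(2)] by (simp add: norm_mult norm_power mult_left_le)
qed

section \<open>Coefficient and growth bounds for convex univalent functions\<close>

text \<open>The sum is geometric with ratio \<open>u ^ j\<close>, whose \<open>n\<close>-th power is
  1. Averaging a power series over the rotations \<open>u ^ k * z\<close> thus keeps only the
  indices divisible by \<open>n\<close>.\<close>

lemma mean_roots_of_unity_power:
  fixes u :: complex
  assumes "n \<ge> 1" and u: "u = exp (2 * of_real pi * \<i> / of_nat n)"
  shows "(\<Sum>k<n. (u ^ k) ^ j) / of_nat n = (if n dvd j then 1 else 0)"
proof -
  have uj: "u ^ j = exp (2 * of_real pi * \<i> * of_nat j / of_nat n)"
    unfolding u by (simp flip: exp_of_nat_mult add: mult_ac)
  have eq: "(\<Sum>k<n. (u ^ k) ^ j) = (\<Sum>k<n. (u ^ j) ^ k)"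
    by (simp flip: power_mult add: mult.commute)
  show ?thesis
  proof (cases "n dvd j")
    case True
    then have "u ^ j = 1" using complex_root_unity_eq_1[OF assms(1), of j] uj by simp
    then show ?thesis using True assms(1) eq by simp
  next
    case False
    then have "u ^ j \<noteq> 1" using complex_root_unity_eq_1[OF assms(1), of j] uj by simp
    moreover have "(u ^ j) ^ n = 1" unfolding uj using assms(1) by (intro complex_root_unity) simp
    ultimately show ?thesis using False eq geometric_sum[of "u ^ j" n] by simp
  qed
qed

text \<open>The mean of \<open>\<phi>\<close> over the \<open>n\<close>-th roots of unity takes values in the convex image
  of \<open>\<phi>\<close>, so it factors through \<open>\<phi>\<close> as \<open>\<phi> \<circ> W\<close> with \<open>W\<close> a self-map of the disk vanishing to
  order \<open>n\<close> at the origin; its leading coefficient is that of \<open>\<phi>\<close>.\<close>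

lemma convex_univalent_coeff_le:
  assumes hol: "\<phi> holomorphic_on unit_disk" and inj: "inj_on \<phi> unit_disk"
    and conv: "convex (\<phi> ` unit_disk)" and phi0: "\<phi> 0 = 0" and dphi: "deriv \<phi> 0 = 1" and n: "n \<ge> 1"
  shows "norm ((deriv ^^ n) \<phi> 0 / fact n) \<le> 1"
proof -
  define A where "A j = (deriv ^^ j) \<phi> 0 / fact j" for j
  define u where "u = exp (2 * of_real pi * \<i> / of_nat n)"
  have [simp]: "norm u = 1"
    unfolding u_def by (simp add: norm_exp_eq_Re)
  define G where "G z = (\<Sum>k<n. \<phi> (u ^ k * z)) / of_nat n" for z
  have A: "(\<lambda>j. A j * z ^ j) sums \<phi> z" if "z \<in> unit_disk" for z
    using holomorphic_power_series[OF hol that] by (simp add: A_def)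
  have A0: "A 0 = 0" by (simp add: A_def phi0)
  have rot: "u ^ k * z \<in> unit_disk" if "z \<in> unit_disk" for k z
    using that by (simp add: norm_mult norm_power)
  have "(\<lambda>j. (if n dvd j then A j else 0) * z ^ j) sums G z" if z: "z \<in> unit_disk" for z
  proof -
    have "(\<lambda>j. (\<Sum>k<n. A j * (u ^ k * z) ^ j) / of_nat n) sums G z"
      unfolding G_def by (intro sums_divide sums_sum A rot z)
    also have "(\<lambda>j. (\<Sum>k<n. A j * (u ^ k * z) ^ j) / of_nat n) =
        (\<lambda>j. A j * z ^ j * ((\<Sum>k<n. (u ^ k) ^ j) / of_nat n))"
      by (simp add: power_mult_distrib sum_distrib_left sum_divide_distrib mult_ac)
    also have "\<dots> = (\<lambda>j. (if n dvd j then A j else 0) * z ^ j)"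
      using mean_roots_of_unity_power[OF n u_def] by auto
    finally show ?thesis .
  qed
  \<comment> \<open>The only index below \<open>n\<close> that \<open>n\<close> divides is 0, and
    \<open>A 0 = 0\<close>; so \<open>A n\<close> is the first coefficient that can survive.\<close>
  then obtain K where K: "K holomorphic_on unit_disk"
      "\<And>z. z \<in> unit_disk \<Longrightarrow> G z = z ^ n * K z" "K 0 = A n"
  proof (rule power_series_factor[of "\<lambda>j. if n dvd j then A j else 0" G n])
    show "(if n dvd j then A j else 0) = 0" if "j < n" for j
      using that A0 by (cases "j = 0") (auto dest: dvd_imp_le)
  qed auto
  have Gim: "G z \<in> \<phi> ` unit_disk" if "z \<in> unit_disk" for z
  proof -
    have "(\<Sum>k<n. (1 / real n) *\<^sub>R \<phi> (u ^ k * z)) \<in> \<phi> ` unit_disk"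
      using n by (intro convex_sum[OF _ conv] imageI rot that) auto
    also have "(\<Sum>k<n. (1 / real n) *\<^sub>R \<phi> (u ^ k * z)) = G z"
      by (simp add: G_def scaleR_conv_of_real sum_divide_distrib)
    finally show ?thesis .
  qed
  obtain \<psi> where psi: "\<psi> holomorphic_on (\<phi> ` unit_disk)"
      "\<And>z. z \<in> unit_disk \<Longrightarrow> deriv \<phi> z * deriv \<psi> (\<phi> z) = 1"
      "\<And>z. z \<in> unit_disk \<Longrightarrow> \<psi> (\<phi> z) = z"
    using holomorphic_has_inverse[OF hol _ inj] by auto
  have psi0: "\<psi> 0 = 0" "deriv \<psi> 0 = 1"
    using psi(2)[of 0] psi(3)[of 0] phi0 dphi by auto
  \<comment> \<open>The removable singularity of \<open>\<psi> w / w\<close> is filled by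
    \<open>deriv \<psi> 0 = 1\<close>. Factoring \<open>w\<close> out of \<open>\<psi>\<close> turns
    \<open>\<psi> (G z)\<close> into \<open>z ^ n\<close> times an analytic function, the form that
    the Schwarz estimate requires.\<close>
  define \<kappa> where "\<kappa> w = (if w = 0 then 1 else \<psi> w / w)" for w
  have chi: "\<kappa> holomorphic_on (\<phi> ` unit_disk)"
    by (rule pole_theorem_open_0[OF psi(1), of 0])
       (use psi0 in \<open>auto simp: \<kappa>_def open_mapping_thm3[OF hol _ inj]\<close>)
  have psichi: "\<psi> w = w * \<kappa> w" for w
    by (simp add: \<kappa>_def psi0)
  have GK: "(\<lambda>z. z ^ n * K z) ` unit_disk \<subseteq> \<phi> ` unit_disk"
    using Gim K(2) by auto
  define V where "V z = K z * \<kappa> (z ^ n * K z)" for z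
  have "V holomorphic_on unit_disk"
    unfolding V_def
    by (intro holomorphic_intros K holomorphic_on_compose_gen[OF _ chi, unfolded o_def] GK)
  moreover have "norm (z ^ n * V z) \<le> 1" if z: "z \<in> unit_disk" for z
  proof -
    have "z ^ n * V z = \<psi> (G z)"
      by (simp add: V_def psichi K(2)[OF z])
    moreover obtain w where "w \<in> unit_disk" "G z = \<phi> w" using Gim[OF z] by auto
    ultimately show ?thesis using psi(3)[of w] by simp
  qed
  ultimately have "norm (V 0) \<le> 1" by (rule Schwarz_quotient_le) auto
  \<comment> \<open>At the origin \<open>n \<ge> 1\<close> makes the argument of
    \<open>\<kappa>\<close> equal to 0, where \<open>\<kappa>\<close> is 1.\<close>
  moreover have "V 0 = A n" using n K(3) by (simp add: V_def \<kappa>_def)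
  ultimately show ?thesis by (simp add: A_def)
qed

text \<open>Coefficients of modulus at most 1 permit termwise comparison with the geometric series
  and its derivative.\<close>

lemma convex_univalent_growth:
  assumes hol: "\<phi> holomorphic_on unit_disk" and inj: "inj_on \<phi> unit_disk"
    and conv: "convex (\<phi> ` unit_disk)" and phi0: "\<phi> 0 = 0" and dphi: "deriv \<phi> 0 = 1"
    and z: "z \<in> unit_disk"
  shows "norm (\<phi> z) \<le> norm z / (1 - norm z)" and "norm (deriv \<phi> z) \<le> 1 / (1 - norm z)\<^sup>2"
proof -
  define A where "A j = (deriv ^^ j) \<phi> 0 / fact j" for j
  have z1: "norm z < 1" using z by simp
  have A: "(\<lambda>j. A j * z ^ j) sums \<phi> z" if "norm z < 1" for z
    using holomorphic_power_series[OF hol, of z] that by (simp add: A_def)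
  have A0: "A 0 = 0" by (simp add: A_def phi0)
  have Ale: "norm (A n) \<le> 1" for n
    using convex_univalent_coeff_le[OF hol inj conv phi0 dphi, of n] A0
    by (cases n) (auto simp: A_def)
  have "(\<phi> has_field_derivative deriv \<phi> z) (at z)"
    using holomorphic_derivI[OF hol _ z] by simp
  from termdiffs_sums_strong[OF A this z1]
  have D: "(\<lambda>n. diffs A n * z ^ n) sums deriv \<phi> z" .
  have S: "(\<lambda>n. A (Suc n) * z ^ Suc n) sums \<phi> z"
    using A[OF z1] A0 by (subst sums_Suc_iff) simp
  have g1: "(\<lambda>n. norm z ^ Suc n) sums (norm z / (1 - norm z))"
    using sums_mult[OF geometric_sums[of "norm z"], of "norm z"] z1 by simp
  have g2: "(\<lambda>n. real (Suc n) * norm z ^ n) sums (1 / (1 - norm z)\<^sup>2)"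
    using geometric_deriv_sums[of "norm z"] z1 by simp
  show "norm (\<phi> z) \<le> norm z / (1 - norm z)"
  proof (rule norm_sums_le[OF S g1])
    fix n show "norm (A (Suc n) * z ^ Suc n) \<le> norm z ^ Suc n"
      using mult_right_mono[OF Ale[of "Suc n"], of "norm z ^ Suc n"]
      by (simp only: norm_mult norm_power) simp
  qed
  show "norm (deriv \<phi> z) \<le> 1 / (1 - norm z)\<^sup>2"
  proof (rule norm_sums_le[OF D g2])
    fix n
    have "norm (diffs A n * z ^ n) = norm (A (Suc n)) * (real (Suc n) * norm z ^ n)"
      by (simp only: diffs_def norm_mult norm_power norm_of_nat mult_ac)
    also have "\<dots> \<le> 1 * (real (Suc n) * norm z ^ n)"
      by (intro mult_right_mono Ale) simp
    finally show "norm (diffs A n * z ^ n) \<le> real (Suc n) * norm z ^ n" by simp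
  qed
qed

section \<open>Analytic maps into a half-plane\<close>

text \<open>For \<open>q > 0\<close> the Moebius map \<open>w / (2 * q - w)\<close> sends the
  half-plane \<open>Re w < q\<close> into the disk, fixes 0 and has derivative
  \<open>1 / (2 * q)\<close> there, so the Schwarz lemma gives \<open>2 * q \<ge> 1\<close>.\<close>

lemma Re_upper_bound_ge_half:
  assumes hol: "\<phi> holomorphic_on unit_disk" and phi0: "\<phi> 0 = 0" and dphi: "norm (deriv \<phi> 0) = 1"
    and le: "\<And>z. z \<in> unit_disk \<Longrightarrow> Re (\<phi> z) \<le> p"
  shows "p \<ge> 1 / 2"
proof (rule field_le_epsilon)
  fix e :: real assume e: "e > 0"
  \<comment> \<open>The margin \<open>e\<close> makes \<open>q\<close> positive and the bound on the
    real part strict, as the Moebius map needs.\<close>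
  define q where "q = p + e"
  have p0: "p \<ge> 0" using le[of 0] phi0 by simp
  have q0: "q > 0" using p0 e by (simp add: q_def)
  have lt: "Re (\<phi> z) < q" if "z \<in> unit_disk" for z
    using le[OF that] e by (simp add: q_def)
  have nz: "2 * q - \<phi> z \<noteq> 0" if "z \<in> unit_disk" for z
    using lt[OF that] q0 by (auto simp: complex_eq_iff)
  define W where "W z = \<phi> z / (2 * q - \<phi> z)" for z
  have W: "W holomorphic_on unit_disk"
    unfolding W_def by (intro holomorphic_intros hol nz)
  have "norm (W z) < 1" if "norm z < 1" for z
  proof -
    have zz: "z \<in> unit_disk" using that by simp
    have "(norm (\<phi> z))\<^sup>2 < (norm (2 * q - \<phi> z))\<^sup>2"
    proof -
      have "(norm (2 * q - \<phi> z))\<^sup>2 - (norm (\<phi> z))\<^sup>2 = 4 * (q * (q - Re (\<phi> z)))"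
        unfolding cmod_power2 by (simp add: power2_eq_square algebra_simps)
      moreover have "q * (q - Re (\<phi> z)) > 0" using lt[OF zz] q0 by simp
      ultimately show ?thesis by linarith
    qed
    then have "norm (\<phi> z) < norm (2 * q - \<phi> z)" by (rule power2_less_imp_less) simp
    moreover have "0 < norm (2 * q - \<phi> z)" using nz[OF zz] unfolding zero_less_norm_iff .
    ultimately show ?thesis by (simp add: W_def norm_divide)
  qed
  then have "norm (deriv W 0) \<le> 1"
    by (intro Schwarz_Lemma(2)[OF W, of 0]) (auto simp: W_def phi0)
  moreover have "deriv W 0 = deriv \<phi> 0 / (2 * q)"
  proof (rule DERIV_imp_deriv)
    have "(\<phi> has_field_derivative deriv \<phi> 0) (at 0)"
      using holomorphic_derivI[OF hol, of 0] by simp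
    then show "(W has_field_derivative deriv \<phi> 0 / (2 * q)) (at 0)"
      unfolding W_def using q0 phi0
      by (auto intro!: derivative_eq_intros simp: field_simps)
  qed
  ultimately have "1 / (2 * q) \<le> 1" using dphi q0 by (simp add: norm_divide norm_mult)
  then show "1 / 2 \<le> p + e" using q0 by (simp add: q_def field_simps)
qed


subsection \<open>Stable convex harmonic mappings\<close>

lemma exists_aligning_rotation:
  fixes a b :: complex
  obtains \<nu> where "norm \<nu> = 1" "norm (a + \<nu> * b) = norm a + norm b"
proof (cases "a = 0 \<or> b = 0")
  case True
  then show ?thesis using that[of 1] by auto
next
  case False
  show ?thesis
  proof (rule that[of "sgn a / sgn b"])
    show "norm (sgn a / sgn b) = 1" using False by (simp add: norm_divide norm_sgn)
    have "a + sgn a / sgn b * b = sgn a * of_real (norm a + norm b)"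
      using False by (simp add: sgn_eq field_simps)
    also have "norm \<dots> = norm a + norm b"
      using False unfolding norm_mult norm_of_real by (simp add: norm_sgn)
    finally show "norm (a + sgn a / sgn b * b) = norm a + norm b" .
  qed
qed

lemma cnj_mult_square_unimodular:
  assumes "norm \<sigma> = 1"
  shows "cnj \<sigma> * (\<sigma>\<^sup>2 * x) = \<sigma> * x"
proof -
  have "cnj \<sigma> * \<sigma> = 1" using assms by (metis complex_norm_square mult.commute of_real_1 power_one)
  then show ?thesis by (simp add: power2_eq_square)
qed

section \<open>The stable family and the comparison of \<open>h\<close> with
  \<open>g\<close>\<close>

locale stable_convex_map =
  fixes h g :: "complex \<Rightarrow> complex"
  assumes SH0: "in_SH0 h g" and stable: "stable_convex h g"
begin

lemma h_hol: "h holomorphic_on unit_disk" and g_hol: "g holomorphic_on unit_disk"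
  and h0: "h 0 = 0" and g0: "g 0 = 0" and dh0: "deriv h 0 = 1" and dg0: "deriv g 0 = 0"
  and dg_less_dh: "z \<in> unit_disk \<Longrightarrow> norm (deriv g z) < norm (deriv h z)"
  using SH0 unfolding in_SH0_def by auto

text \<open>The harmonic family of the stability hypothesis; \<open>twist 1\<close> is the given
  mapping itself.\<close>

definition twist :: "complex \<Rightarrow> complex \<Rightarrow> complex" where
  "twist \<mu> z = h z + \<mu> * cnj (g z)"

text \<open>The analytic counterpart of \<open>twist\<close>, to which the bounds for convex
  univalent functions will apply.\<close>

definition shear :: "complex \<Rightarrow> complex \<Rightarrow> complex" where
  "shear \<nu> z = h z + \<nu> * g z"

lemma twist_inj: "norm \<mu> = 1 \<Longrightarrow> inj_on (twist \<mu>) unit_disk"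
  and twist_convex: "norm \<mu> = 1 \<Longrightarrow> convex (twist \<mu> ` unit_disk)"
  using stable unfolding stable_convex_def twist_def[abs_def] by auto

lemma twist_cont: "continuous_on unit_disk (twist \<mu>)"
  unfolding twist_def[abs_def]
  by (intro continuous_intros holomorphic_on_imp_continuous_on h_hol g_hol)

lemma shear_hol: "shear \<nu> holomorphic_on unit_disk"
  unfolding shear_def[abs_def] by (intro holomorphic_intros h_hol g_hol)

lemma deriv_shear: "z \<in> unit_disk \<Longrightarrow> deriv (shear \<nu>) z = deriv h z + \<nu> * deriv g z"
  unfolding shear_def[abs_def] using h_hol g_hol
  by (intro DERIV_imp_deriv DERIV_add DERIV_cmult holomorphic_derivI) auto

lemma shear_0: "shear \<nu> 0 = 0" and deriv_shear_0: "deriv (shear \<nu>) 0 = 1"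
  by (simp_all add: shear_def h0 g0 deriv_shear dh0 dg0)

text \<open>If \<open>|h z - h w| = |g z - g w|\<close>, some unimodular \<open>\<mu>\<close> makes \<open>h + \<mu> cnj g\<close> agree at \<open>z\<close> and \<open>w\<close>.\<close>

lemma norm_diff_neq:
  assumes "z \<in> unit_disk" "w \<in> unit_disk" "z \<noteq> w"
  shows "norm (h z - h w) \<noteq> norm (g z - g w)"
proof
  assume eq: "norm (h z - h w) = norm (g z - g w)"
  \<comment> \<open>If \<open>g z = g w\<close>, the assumed equality forces
    \<open>h z = h w\<close>, and the default 1 serves as a unimodular value.\<close>
  define \<mu> where "\<mu> = (if g z = g w then 1 else - (h z - h w) / cnj (g z - g w))"
  have "norm \<mu> = 1"
    using eq unfolding \<mu>_def
    by (simp add: norm_divide norm_minus_commute[of "h w"] flip: complex_cnj_diff)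
  moreover have "twist \<mu> z = twist \<mu> w"
  proof (cases "g z = g w")
    case True
    then show ?thesis using eq by (simp add: twist_def)
  next
    case False
    then have "cnj (g z - g w) \<noteq> 0" by simp
    then have "\<mu> * cnj (g z - g w) = - (h z - h w)" using False by (simp add: \<mu>_def)
    then show ?thesis by (simp add: twist_def algebra_simps)
  qed
  ultimately show False using inj_onD[OF twist_inj] assms by blast
qed

text \<open>The difference of the two sides has no zero on the punctured disk, which is connected,
  so its sign is constant. Near \<open>z\<close> it is positive, because the difference quotients
  tend to derivatives with \<open>norm (deriv g z) < norm (deriv h z)\<close>.\<close>

lemma norm_diff_less:
  assumes z: "z \<in> unit_disk" and w: "w \<in> unit_disk" and zw: "w \<noteq> z"
  shows "norm (g w - g z) < norm (h w - h z)"
proof -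
  define s where "s w = norm (h w - h z) - norm (g w - g z)" for w
  have conn: "connected (s ` (unit_disk - {z}))"
    unfolding s_def
    by (intro connected_continuous_image connected_open_delete continuous_intros
        holomorphic_on_imp_continuous_on holomorphic_on_subset[OF h_hol] holomorphic_on_subset[OF g_hol])
       auto
  have nz: "s w \<noteq> 0" if "w \<in> unit_disk - {z}" for w
    using norm_diff_neq[of w z] that z by (auto simp: s_def)
  have "((\<lambda>w. norm ((h w - h z) / (w - z)) - norm ((g w - g z) / (w - z)))
          \<longlongrightarrow> norm (deriv h z) - norm (deriv g z)) (at z)"
    using holomorphic_derivI[OF h_hol _ z] holomorphic_derivI[OF g_hol _ z]
    by (intro tendsto_intros) (auto simp: has_field_derivative_iff)
  then have "\<forall>\<^sub>F w in at z. norm ((h w - h z) / (w - z)) - norm ((g w - g z) / (w - z)) > 0"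
    using dg_less_dh[OF z] by (intro order_tendstoD(1)) auto
  moreover have "\<forall>\<^sub>F w in at z. w \<in> unit_disk \<and> w \<noteq> z"
    using z by (intro eventually_conj eventually_at_in_open' eventually_neq_at_within) auto
  ultimately have "\<forall>\<^sub>F w in at z. w \<in> unit_disk - {z} \<and> s w > 0"
  proof eventually_elim
    case (elim w)
    then show ?case
      by (auto simp: s_def norm_divide zero_less_divide_iff simp flip: diff_divide_distrib)
  qed
  then obtain w0 where w0: "w0 \<in> unit_disk - {z}" "s w0 > 0"
    using eventually_happens[of _ "at z"] by (auto simp: trivial_limit_at)
  have "s w > 0"
  proof (rule ccontr)
    assume "\<not> s w > 0"
    then have "0 \<in> s ` (unit_disk - {z})"
      using connectedD_interval[OF conn, of "s w" "s w0" 0] w0 w zw by auto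
    then show False using nz by (metis imageE)
  qed
  then show ?thesis by (simp add: s_def)
qed

section \<open>Univalence and convexity of the analytic shears\<close>

lemma shear_inj:
  assumes "norm \<nu> = 1"
  shows "inj_on (shear \<nu>) unit_disk"
proof (rule inj_onI, rule ccontr)
  fix z w assume zw: "z \<in> unit_disk" "w \<in> unit_disk" "shear \<nu> z = shear \<nu> w" "z \<noteq> w"
  then have "h z - h w = - (\<nu> * (g z - g w))" by (simp add: shear_def algebra_simps)
  then have "norm (h z - h w) = norm (g z - g w)" using assms by (simp add: norm_mult)
  then show False using norm_diff_neq zw by blast
qed

text \<open>With \<open>x = cnj \<sigma> * \<nu> * g z\<close>, the rotated second term of this
  \<open>twist\<close> is \<open>- cnj x\<close>, which has the imaginary part of
  \<open>x\<close>.\<close>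

lemma Im_rotated_eq:
  assumes "norm \<sigma> = 1"
  shows "Im (cnj \<sigma> * twist (- (\<sigma>\<^sup>2 * cnj \<nu>)) z) = Im (cnj \<sigma> * shear \<nu> z)"
proof -
  have E: "cnj \<sigma> * twist (- (\<sigma>\<^sup>2 * cnj \<nu>)) z = cnj \<sigma> * h z - cnj (cnj \<sigma> * (\<nu> * g z))"
    by (simp add: twist_def ring_distribs mult.assoc cnj_mult_square_unimodular[OF assms])
  show ?thesis unfolding E by (simp add: shear_def algebra_simps)
qed

text \<open>With the opposite sign the term becomes \<open>cnj x\<close>, which has the real part of
  \<open>x\<close>. This carries half-plane bounds from \<open>twist\<close> to
  \<open>shear\<close>.\<close>

lemma Re_rotated_eq:
  assumes "norm \<sigma> = 1"
  shows "Re (cnj \<sigma> * twist (\<sigma>\<^sup>2 * cnj \<nu>) z) = Re (cnj \<sigma> * shear \<nu> z)"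
proof -
  have E: "cnj \<sigma> * twist (\<sigma>\<^sup>2 * cnj \<nu>) z = cnj \<sigma> * h z + cnj (cnj \<sigma> * (\<nu> * g z))"
    by (simp add: twist_def ring_distribs mult.assoc cnj_mult_square_unimodular[OF assms])
  show ?thesis unfolding E by (simp add: shear_def algebra_simps)
qed

text \<open>The shear argument of Clunie and Sheil-Small: with \<open>\<sigma>\<close> the direction of the segment, \<open>shear \<nu>\<close> and
  \<open>twist \<mu>\<close> for \<open>\<mu> = - \<sigma>\<^sup>2 cnj \<nu>\<close> have the same component orthogonal to \<open>\<sigma>\<close>. Hence \<open>shear \<nu>\<close> maps the
  preimage under \<open>twist \<mu>\<close> of a segment parallel to \<open>\<sigma>\<close> onto a connected subset of a line.\<close>

lemma shear_convex:
  assumes nu: "norm \<nu> = 1"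
  shows "convex (shear \<nu> ` unit_disk)"
  unfolding convex_contains_segment
proof (intro ballI)
  fix P Q assume PQ: "P \<in> shear \<nu> ` unit_disk" "Q \<in> shear \<nu> ` unit_disk"
  then obtain z w where z: "z \<in> unit_disk" "P = shear \<nu> z" and w: "w \<in> unit_disk" "Q = shear \<nu> w"
    by auto
  show "closed_segment P Q \<subseteq> shear \<nu> ` unit_disk"
  proof (cases "P = Q")
    case True
    then show ?thesis using PQ(1) by simp
  next
    case False
    define \<sigma> where "\<sigma> = sgn (Q - P)"
    have sig: "norm \<sigma> = 1" using False by (simp add: \<sigma>_def norm_sgn)
    have sig2: "cnj \<sigma> * \<sigma> = 1"
      using sig by (metis complex_norm_square mult.commute of_real_1 power_one)
    have QP: "Q = P + of_real (norm (Q - P)) * \<sigma>"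
      using False by (simp add: \<sigma>_def sgn_eq)
    define \<mu> where "\<mu> = - (\<sigma>\<^sup>2 * cnj \<nu>)"
    have mu: "norm \<mu> = 1" by (simp add: \<mu>_def norm_mult norm_power sig nu)
    have Im_eq: "Im (cnj \<sigma> * twist \<mu> x) = Im (cnj \<sigma> * shear \<nu> x)" for x
      unfolding \<mu>_def by (rule Im_rotated_eq[OF sig])
    \<comment> \<open>Invariance of domain makes the inverse of \<open>twist \<mu>\<close>
      continuous, so preimages of segments stay connected.\<close>
    obtain F where F: "homeomorphism unit_disk (twist \<mu> ` unit_disk) (twist \<mu>) F"
      using invariance_of_domain_homeomorphism[OF open_ball twist_cont _ twist_inj[OF mu]] by auto
    define S where "S = closed_segment (twist \<mu> z) (twist \<mu> w)"
    have SD: "S \<subseteq> twist \<mu> ` unit_disk"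
      unfolding S_def using closed_segment_subset[OF _ _ twist_convex[OF mu]] z w by auto
    have FD: "F ` S \<subseteq> unit_disk"
      using F SD by (auto simp: homeomorphism_def)
    define C where "C = (\<lambda>x. Re (cnj \<sigma> * shear \<nu> (F x))) ` S"
    have "continuous_on S F"
      using continuous_on_subset[OF homeomorphism_cont2[OF F] SD] .
    then have "continuous_on S (\<lambda>x. shear \<nu> (F x))"
      by (rule continuous_on_compose2[OF holomorphic_on_imp_continuous_on[OF shear_hol] _ FD])
    then have "connected C"
      unfolding C_def
      by (intro connected_continuous_image continuous_intros) (simp_all add: S_def)
    moreover have "Re (cnj \<sigma> * P) \<in> C" "Re (cnj \<sigma> * Q) \<in> C"
      using homeomorphism_apply1[OF F] z w unfolding C_def S_def by (metis ends_in_segment image_eqI)+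
    ultimately have C: "closed_segment (Re (cnj \<sigma> * P)) (Re (cnj \<sigma> * Q)) \<subseteq> C"
      by (intro closed_segment_subset) (simp_all add: connected_convex_1_gen)
    have Imc: "Im (cnj \<sigma> * Q) = Im (cnj \<sigma> * P)"
      using sig2 by (subst QP) (simp add: ring_distribs mult.left_commute)
    \<comment> \<open>The end points of \<open>S\<close> inherit the rotated imaginary parts of
      \<open>P\<close> and \<open>Q\<close> through \<open>Im_eq\<close>. These agree, since
      \<open>Q - P\<close> is a real multiple of \<open>\<sigma>\<close>.\<close>
    have Sc: "Im (cnj \<sigma> * x) = Im (cnj \<sigma> * P)" if x: "x \<in> S" for x
    proof -
      obtain t where "x = (1 - t) *\<^sub>R twist \<mu> z + t *\<^sub>R twist \<mu> w"
        using x unfolding S_def in_segment by auto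
      then have "cnj \<sigma> * x = (1 - t) *\<^sub>R (cnj \<sigma> * twist \<mu> z) + t *\<^sub>R (cnj \<sigma> * twist \<mu> w)"
        by (simp add: ring_distribs)
      then have "Im (cnj \<sigma> * x) = (1 - t) * Im (cnj \<sigma> * twist \<mu> z) + t * Im (cnj \<sigma> * twist \<mu> w)"
        by (simp only: plus_complex.sel scaleR_complex.sel)
      then show ?thesis using z w Imc by (simp only: Im_eq) (simp add: algebra_simps)
    qed
    show ?thesis
    proof
      fix y assume "y \<in> closed_segment P Q"
      then obtain t where t: "0 \<le> t" "t \<le> 1" "y = (1 - t) *\<^sub>R P + t *\<^sub>R Q"
        unfolding in_segment by auto
      then have y: "cnj \<sigma> * y = (1 - t) *\<^sub>R (cnj \<sigma> * P) + t *\<^sub>R (cnj \<sigma> * Q)"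
        by (simp add: ring_distribs)
      have "Re (cnj \<sigma> * y) = (1 - t) * Re (cnj \<sigma> * P) + t * Re (cnj \<sigma> * Q)"
        unfolding y by (simp only: plus_complex.sel scaleR_complex.sel)
      then have "Re (cnj \<sigma> * y) \<in> closed_segment (Re (cnj \<sigma> * P)) (Re (cnj \<sigma> * Q))"
        using t unfolding in_segment by auto
      \<comment> \<open>The real part of \<open>y\<close> is matched within the interval contained
        in \<open>C\<close>; the imaginary part then agrees because it is constant on
        \<open>S\<close>.\<close>
      then obtain x where x: "x \<in> S" "Re (cnj \<sigma> * y) = Re (cnj \<sigma> * shear \<nu> (F x))"
        using C unfolding C_def by auto
      have "Im (cnj \<sigma> * y) = (1 - t) * Im (cnj \<sigma> * P) + t * Im (cnj \<sigma> * Q)"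
        unfolding y by (simp only: plus_complex.sel scaleR_complex.sel)
      also have "\<dots> = Im (cnj \<sigma> * P)" unfolding Imc by (simp add: algebra_simps)
      also have "\<dots> = Im (cnj \<sigma> * twist \<mu> (F x))"
        using Sc[OF x(1)] homeomorphism_apply2[OF F] x(1) SD by (metis subsetD)
      also have "\<dots> = Im (cnj \<sigma> * shear \<nu> (F x))" by (rule Im_eq)
      finally have "cnj \<sigma> * y = cnj \<sigma> * shear \<nu> (F x)" using x(2) complex_eqI by blast
      then have "y = shear \<nu> (F x)" using sig2 by auto
      then show "y \<in> shear \<nu> ` unit_disk" using FD x(1) by blast
    qed
  qed
qed

section \<open>Growth estimates\<close>

text \<open>Every unimodular \<open>\<nu>\<close> gives a convex univalent shear, so
  \<open>\<nu>\<close> may be chosen after \<open>z\<close>, and separately for the values and for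
  the derivatives.\<close>

lemma growth:
  assumes z: "z \<in> unit_disk"
  shows "norm (h z) + norm (g z) \<le> norm z / (1 - norm z)"
    and "norm (deriv h z) + norm (deriv g z) \<le> 1 / (1 - norm z)\<^sup>2"
proof -
  obtain \<nu> where nu: "norm \<nu> = 1" "norm (h z + \<nu> * g z) = norm (h z) + norm (g z)"
    by (rule exists_aligning_rotation)
  show "norm (h z) + norm (g z) \<le> norm z / (1 - norm z)"
    using convex_univalent_growth(1)[OF shear_hol shear_inj[OF nu(1)] shear_convex[OF nu(1)] shear_0 deriv_shear_0 z]
    by (simp only: shear_def nu(2))
  obtain \<nu> where nu: "norm \<nu> = 1"
      "norm (deriv h z + \<nu> * deriv g z) = norm (deriv h z) + norm (deriv g z)"
    by (rule exists_aligning_rotation)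
  show "norm (deriv h z) + norm (deriv g z) \<le> 1 / (1 - norm z)\<^sup>2"
    using convex_univalent_growth(2)[OF shear_hol shear_inj[OF nu(1)] shear_convex[OF nu(1)] shear_0 deriv_shear_0 z]
    by (simp only: deriv_shear[OF z] nu(2))
qed

section \<open>Distance from the origin to the boundary of the image\<close>

lemma harm_eq_twist: "harm h g = twist 1"
  by (simp add: harm_def twist_def[abs_def])

text \<open>Since \<open>|f z - f w| \<le> 2 |h z - h w|\<close>, surjectivity of \<open>f\<close> onto the plane would make the image of
  the univalent function \<open>h\<close> closed, contradicting Liouville's theorem.\<close>

lemma harm_image_neq_UNIV: "harm h g ` unit_disk \<noteq> UNIV"
proof
  assume U: "harm h g ` unit_disk = UNIV"
  \<comment> \<open>Under the surjectivity assumption the inverse \<open>F\<close> is continuous on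
    the whole plane, so any limit of values can be pulled back into the disk.\<close>
  obtain F where F: "homeomorphism unit_disk UNIV (twist 1) F"
    using invariance_of_domain_homeomorphism[OF open_ball twist_cont _ twist_inj[of 1]] U
    by (auto simp: harm_eq_twist)
  have h_inj: "inj_on h unit_disk"
    by (rule inj_onI) (metis norm_diff_less norm_not_less_zero norm_zero right_minus_eq)
  have lip: "norm (twist 1 z - twist 1 w) \<le> 2 * norm (h z - h w)"
    if "z \<in> unit_disk" "w \<in> unit_disk" for z w
  proof -
    have "twist 1 z - twist 1 w = (h z - h w) + cnj (g z - g w)" by (simp add: twist_def)
    then have "norm (twist 1 z - twist 1 w) \<le> norm (h z - h w) + norm (g z - g w)"
      by (metis complex_mod_cnj norm_triangle_ineq)
    moreover have "norm (g z - g w) \<le> norm (h z - h w)"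
      using norm_diff_less[of w z] that by (cases "z = w") auto
    ultimately show ?thesis by linarith
  qed
  have "closed (h ` unit_disk)"
    unfolding closed_sequential_limits
  proof (intro allI impI, elim conjE)
    fix x l assume x: "\<forall>n. x n \<in> h ` unit_disk" and l: "x \<longlonglongrightarrow> l"
    obtain z where z: "\<And>n. z n \<in> unit_disk" "\<And>n. x n = h (z n)"
      using x unfolding image_iff by metis
    \<comment> \<open>By \<open>lip\<close>, convergence of the values of \<open>h\<close> controls
      the values of \<open>twist 1\<close>.\<close>
    have "Cauchy (\<lambda>n. twist 1 (z n))"
    proof (rule metric_CauchyI)
      fix e :: real assume "e > 0"
      then obtain M where M: "\<And>m n. m \<ge> M \<Longrightarrow> n \<ge> M \<Longrightarrow> dist (x m) (x n) < e / 2"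
        using metric_CauchyD[OF LIMSEQ_imp_Cauchy[OF l], of "e / 2"] by auto
      show "\<exists>M. \<forall>m\<ge>M. \<forall>n\<ge>M. dist (twist 1 (z m)) (twist 1 (z n)) < e"
      proof (intro exI allI impI)
        fix m n assume "m \<ge> M" "n \<ge> M"
        then show "dist (twist 1 (z m)) (twist 1 (z n)) < e"
          using M[of m n] lip[OF z(1) z(1), of m n] by (simp add: dist_norm z(2))
      qed
    qed
    then obtain v where v: "(\<lambda>n. twist 1 (z n)) \<longlonglongrightarrow> v"
      using Cauchy_convergent convergent_def by blast
    have "isCont F v" using F by (simp add: homeomorphism_def continuous_on_eq_continuous_at)
    then have "(\<lambda>n. F (twist 1 (z n))) \<longlonglongrightarrow> F v" using v by (rule isCont_tendsto_compose)
    then have zF: "z \<longlonglongrightarrow> F v" using homeomorphism_apply1[OF F z(1)] by simp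
    have Fv: "F v \<in> unit_disk" using F by (auto simp: homeomorphism_def)
    then have "isCont h (F v)"
      using holomorphic_on_imp_continuous_on[OF h_hol]
      by (simp add: continuous_on_eq_continuous_at)
    then have "(\<lambda>n. h (z n)) \<longlonglongrightarrow> h (F v)" using zF by (rule isCont_tendsto_compose)
    moreover have "x = (\<lambda>n. h (z n))" using z(2) by auto
    ultimately have "l = h (F v)" using l LIMSEQ_unique by simp
    then show "l \<in> h ` unit_disk" using Fv by blast
  qed
  moreover have "open (h ` unit_disk)" using open_mapping_thm3[OF h_hol _ h_inj] by simp
  ultimately have hU: "h ` unit_disk = UNIV"
    using clopen[of "h ` unit_disk"] by auto
  obtain \<psi> where psi: "\<psi> holomorphic_on (h ` unit_disk)" "\<And>z. z \<in> unit_disk \<Longrightarrow> \<psi> (h z) = z"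
    using holomorphic_has_inverse[OF h_hol open_ball h_inj] by metis
  have "\<psi> w \<in> unit_disk" for w
    using psi(2) hU by (metis UNIV_I imageE)
  then have "bounded (range \<psi>)"
    by (intro bounded_subset[OF bounded_ball]) blast
  then have "\<psi> constant_on UNIV"
    using psi(1) unfolding hU by (intro Liouville_theorem)
  then obtain c where "\<And>w. \<psi> w = c" by (auto simp: constant_on_def)
  then show False using psi(2)[of 0] psi(2)[of "1/2"] by simp
qed

lemma dist_bdry_ge: "dist_bdry (harm h g) \<ge> 1 / 2"
proof -
  let ?S = "twist 1 ` unit_disk"
  have op: "open ?S" using invariance_of_domain[OF twist_cont open_ball twist_inj] by simp
  have z0: "0 \<in> ?S" by (rule image_eqI[of _ _ 0]) (simp_all add: twist_def h0 g0)
  \<comment> \<open>needed because \<open>infdist x {} = 0\<close>\<close>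
  have ne: "frontier ?S \<noteq> {}"
    using frontier_not_empty[of ?S] harm_image_neq_UNIV z0 by (auto simp: harm_eq_twist)
  have "1 / 2 \<le> dist 0 b" if b: "b \<in> frontier ?S" for b
  proof -
    have "b \<in> closure ?S" "b \<notin> rel_interior ?S"
      using b op z0 by (auto simp: frontier_def interior_open rel_interior_open)
    then obtain a where a: "a \<noteq> 0" "\<And>y. y \<in> closure ?S \<Longrightarrow> a \<bullet> b \<le> a \<bullet> y"
      using supporting_hyperplane_relative_frontier[OF twist_convex[of 1]] by (metis norm_one)
    \<comment> \<open>The image lies on the side into which \<open>a\<close> points, so this is the
      outward unit normal of the supporting line.\<close>
    define \<sigma> where "\<sigma> = - sgn a"
    have sig: "norm \<sigma> = 1" using a(1) by (simp add: \<sigma>_def norm_sgn)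
    have inner: "Re (cnj \<sigma> * y) = - (a \<bullet> y) / norm a" for y
      using a(1) by (simp add: \<sigma>_def sgn_eq inner_complex_def field_simps flip: add_divide_distrib)
    \<comment> \<open>Chosen so that the coefficient \<open>\<sigma>\<^sup>2 * cnj \<nu>\<close> in
      \<open>Re_rotated_eq\<close> is 1, which selects \<open>twist 1\<close>.\<close>
    define \<nu> where "\<nu> = \<sigma>\<^sup>2"
    have nu: "\<sigma>\<^sup>2 * cnj \<nu> = 1"
      unfolding \<nu>_def using sig
      by (metis complex_cnj_power complex_norm_square of_real_1 power_mult_distrib power_one)
    have "1 / 2 \<le> Re (cnj \<sigma> * b)"
    proof (rule Re_upper_bound_ge_half[of "\<lambda>z. cnj \<sigma> * shear \<nu> z"])
      show "(\<lambda>z. cnj \<sigma> * shear \<nu> z) holomorphic_on unit_disk"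
        by (intro holomorphic_intros shear_hol)
      have "shear \<nu> field_differentiable at 0"
        using holomorphic_on_imp_differentiable_at[OF shear_hol] by simp
      then show "norm (deriv (\<lambda>z. cnj \<sigma> * shear \<nu> z) 0) = 1"
        using sig by (simp add: deriv_cmult deriv_shear_0)
      fix z :: complex assume z: "z \<in> unit_disk"
      have "a \<bullet> b \<le> a \<bullet> twist 1 z" by (rule a(2)[OF subsetD[OF closure_subset imageI[OF z]]])
      then have "Re (cnj \<sigma> * twist 1 z) \<le> Re (cnj \<sigma> * b)"
        unfolding inner by (intro divide_right_mono) auto
      then show "Re (cnj \<sigma> * shear \<nu> z) \<le> Re (cnj \<sigma> * b)"
        using Re_rotated_eq[OF sig, of \<nu> z] nu by simp
    qed (simp add: shear_0)
    also have "\<dots> \<le> norm (cnj \<sigma> * b)" by (rule complex_Re_le_cmod)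
    also have "\<dots> = dist 0 b" using sig by (simp add: norm_mult)
    finally show ?thesis .
  qed
  then have "1 / 2 \<le> infdist 0 (frontier ?S)"
    unfolding infdist_notempty[OF ne] by (intro cINF_greatest ne)
  then show ?thesis by (simp add: dist_bdry_def harm_eq_twist twist_def h0 g0)
qed

end


subsection \<open>The radius and its sharpness\<close>

text \<open>At \<open>x = r ^ m\<close> this is the left side of the radius equation up to 1/2; at
  \<open>x = norm w\<close> it will bound both operator expressions at \<open>w\<close>.\<close>

definition radius_fun :: "real \<Rightarrow> real \<Rightarrow> real" where
  "radius_fun lam x = (1 - lam) * x / (1 - x) + lam * x / (1 - x)\<^sup>2"

lemma radius_fun_strict_mono:
  assumes "0 \<le> lam" "lam \<le> 1" "0 \<le> x" "x < y" "y < 1"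
  shows "radius_fun lam x < radius_fun lam y"
proof -
  have less1: "x / (1 - x) < y / (1 - y)"
    using assms by (simp add: field_simps)
  have "x / (1 - x)\<^sup>2 = x / (1 - x) * (1 / (1 - x))" by (simp add: power2_eq_square)
  also have "\<dots> < y / (1 - y) * (1 / (1 - y))"
    using assms less1 by (intro mult_strict_mono) (auto simp: frac_less2)
  also have "\<dots> = y / (1 - y)\<^sup>2" by (simp add: power2_eq_square)
  finally have less2: "x / (1 - x)\<^sup>2 < y / (1 - y)\<^sup>2" .
  have "(1 - lam) * (x / (1 - x)) + lam * (x / (1 - x)\<^sup>2) <
      (1 - lam) * (y / (1 - y)) + lam * (y / (1 - y)\<^sup>2)"
  \<comment> \<open>For \<open>lam = 0\<close> strictness comes from the first term; otherwise from
    the second, as the first vanishes at \<open>lam = 1\<close>.\<close>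
  proof (cases "lam = 0")
    case True
    then show ?thesis using less1 by simp
  next
    case False
    then show ?thesis using less1 less2 assms
      by (intro add_le_less_mono mult_left_mono mult_strict_left_mono) auto
  qed
  then show ?thesis by (simp add: radius_fun_def)
qed

lemma root_eq_radius_fun: "root_eq lam m r = radius_fun lam (r ^ m) - 1 / 2"
  by (simp add: root_eq_def radius_fun_def)

lemma root_eq_ex1:
  assumes m: "m \<ge> 1" and lam: "0 \<le> lam" "lam \<le> 1"
  obtains r6 where "r6 \<in> {0<..<1}" "root_eq lam m r6 = 0"
    "\<And>r. r \<in> {0<..<1} \<Longrightarrow> root_eq lam m r = 0 \<Longrightarrow> r = r6"
proof -
  \<comment> \<open>At \<open>s\<close> the left side equals \<open>1 / 2 + lam\<close>, hence is
    nonnegative, and on \<open>{0..s}\<close> the pole at 1 is avoided.\<close>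
  define s where "s = root m (1 / 2)"
  have s: "0 < s" "s < 1" "s ^ m = 1 / 2" using m by (auto simp: s_def)
  have pow1: "x ^ m < 1" if "0 \<le> x" "x \<le> s" for x
    using power_mono[of x s m] that s by linarith
  have "continuous_on {0..s} (\<lambda>r. root_eq lam m r)"
    unfolding root_eq_def by (intro continuous_intros) (use pow1 in force)+
  moreover have lo: "root_eq lam m 0 = - 1 / 2" using m by (simp add: root_eq_def zero_power)
  moreover have "root_eq lam m s \<ge> 0"
    unfolding root_eq_def s(3) using lam by (simp add: power2_eq_square field_simps)
  ultimately obtain r where r: "0 \<le> r" "r \<le> s" "root_eq lam m r = 0"
    using IVT'[of "root_eq lam m" 0 0 s] s by auto
  have "r \<noteq> 0" using r(3) lo by auto
  then have r01: "r \<in> {0<..<1}" using r s by auto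
  show thesis
  proof (rule that[OF r01 r(3)], rule ccontr)
    fix q assume q: "q \<in> {0<..<1}" "root_eq lam m q = 0" "q \<noteq> r"
    have *: "root_eq lam m x < root_eq lam m y" if "0 < x" "x < y" "y < 1" for x y
      unfolding root_eq_radius_fun
      using radius_fun_strict_mono[OF lam, of "x ^ m" "y ^ m"] that m
      by (simp add: power_strict_mono power_less_one_iff)
    show False using *[of q r] *[of r q] q r01 r(3) by (cases q r rule: linorder_cases) auto
  qed
qed

section \<open>The extremal half-plane map\<close>

text \<open>The inverse is \<open>w / (1 + w)\<close>, so the image consists of the points nearer to
  0 than to -1. The inner product form fits the general facts on half-spaces.\<close>

lemma half_plane_map_bij:
  "inj_on (\<lambda>z. z / (1 - z)) unit_disk"
  "(\<lambda>z. z / (1 - z)) ` unit_disk = {w. 1 \<bullet> w > - 1 / 2}"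
proof -
  have ne: "1 - z \<noteq> 0" if "z \<in> unit_disk" for z :: complex using that by auto
  show "inj_on (\<lambda>z. z / (1 - z)) unit_disk"
    using ne by (intro inj_onI) (simp add: frac_eq_eq algebra_simps)
  have norm_less: "norm w < norm (1 + w) \<longleftrightarrow> Re w > - 1 / 2" for w :: complex
  proof -
    have "norm w < norm (1 + w) \<longleftrightarrow> (norm w)\<^sup>2 < (norm (1 + w))\<^sup>2"
      by (metis norm_ge_zero pos2 power_less_imp_less_base power_strict_mono)
    also have "(norm (1 + w))\<^sup>2 = (norm w)\<^sup>2 + (1 + 2 * Re w)"
      unfolding cmod_power2 by (simp add: power2_eq_square algebra_simps)
    finally show ?thesis by linarith
  qed
  show "(\<lambda>z. z / (1 - z)) ` unit_disk = {w. 1 \<bullet> w > - 1 / 2}"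
  proof (intro equalityI subsetI)
    fix w assume "w \<in> (\<lambda>z. z / (1 - z)) ` unit_disk"
    then obtain z where z: "z \<in> unit_disk" "w = z / (1 - z)" by auto
    then have "1 + w = 1 / (1 - z)" using ne by (simp add: field_simps)
    moreover have "norm z < 1" using z by simp
    ultimately have "norm w < norm (1 + w)"
      using z ne by (simp add: norm_divide divide_strict_right_mono)
    then show "w \<in> {w. 1 \<bullet> w > - 1 / 2}" using norm_less by (simp add: inner_complex_def)
  next
    fix w :: complex assume "w \<in> {w. 1 \<bullet> w > - 1 / 2}"
    then have lt: "norm w < norm (1 + w)" using norm_less by (simp add: inner_complex_def)
    then have nz: "1 + w \<noteq> 0" by auto
    have "w = (w / (1 + w)) / (1 - w / (1 + w))" using nz by (simp add: field_simps)
    moreover have "w / (1 + w) \<in> unit_disk" using lt nz by (simp add: norm_divide)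
    ultimately show "w \<in> (\<lambda>z. z / (1 - z)) ` unit_disk" by blast
  qed
qed

lemma deriv_half_plane_map:
  assumes "z \<noteq> 1"
  shows "deriv (\<lambda>z::complex. z / (1 - z)) z = 1 / (1 - z)\<^sup>2"
  using assms
  by (intro DERIV_imp_deriv) (auto intro!: derivative_eq_intros simp: power2_eq_square field_simps)

text \<open>With \<open>g = 0\<close> the whole stable family reduces to the half-plane map. The
  boundary point -1/2 bounds the distance from above, the direction needed for sharpness.\<close>

lemma half_plane_map_stable_convex:
  "in_SH0 (\<lambda>z. z / (1 - z)) (\<lambda>_. 0)" "stable_convex (\<lambda>z. z / (1 - z)) (\<lambda>_. 0)"
  "dist_bdry (harm (\<lambda>z. z / (1 - z)) (\<lambda>_. 0)) \<le> 1 / 2"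
proof -
  have ne: "z \<noteq> 1" if "norm z < 1" for z :: complex using that by auto
  show "in_SH0 (\<lambda>z. z / (1 - z)) (\<lambda>_. 0)"
    unfolding in_SH0_def using half_plane_map_bij(1)
    by (auto intro!: holomorphic_intros simp: harm_def deriv_half_plane_map ne)
  have "convex {w :: complex. 1 \<bullet> w > - 1 / 2}" by (rule convex_halfspace_gt)
  then show "stable_convex (\<lambda>z. z / (1 - z)) (\<lambda>_. 0)"
    unfolding stable_convex_def using half_plane_map_bij by simp
  have "frontier {w :: complex. 1 \<bullet> w > - 1 / 2} = {w. 1 \<bullet> w = - 1 / 2}"
    by (rule frontier_halfspace_gt) simp
  then have "- 1 / 2 \<in> frontier (harm (\<lambda>z. z / (1 - z)) (\<lambda>_. 0) ` unit_disk)"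
    by (simp add: harm_def half_plane_map_bij(2) inner_complex_def)
  from infdist_le[OF this, of 0]
  show "dist_bdry (harm (\<lambda>z. z / (1 - z)) (\<lambda>_. 0)) \<le> 1 / 2"
    by (simp add: dist_bdry_def harm_def)
qed

lemma power_in_B_class: "(\<lambda>z. z ^ m) \<in> B_class m"
  \<comment> \<open>The derivative of order \<open>k\<close> at 0 carries the factor
    \<open>0 ^ (m - k)\<close>; for \<open>k = m\<close> there remains a \<open>pochhammer\<close>
    value equal to \<open>fact m\<close>.\<close>
  unfolding B_class_def
  using higher_deriv_power[where z = "0 :: complex" and w = 0 and n = m]
  by (auto intro!: holomorphic_intros power_le_one simp: norm_power simp flip: pochhammer_fact)

text \<open>At a positive real point all terms are positive reals, so the norm is exactly
  \<open>radius_fun lam (r ^ m)\<close>; with \<open>g = 0\<close> the two operators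
  coincide.\<close>

lemma half_plane_map_exceeds:
  assumes "0 \<le> lam" "lam \<le> 1" "0 < r" "r < 1" "m \<ge> 1" "root_eq lam m r > 0"
  defines "h \<equiv> \<lambda>z. z / (1 - z)" and "g \<equiv> \<lambda>_. 0" and "z \<equiv> complex_of_real r"
  shows "norm ((1 - of_real lam) * harm h g (z ^ m) + of_real lam * Dop h g (z ^ m)) > dist_bdry (harm h g)"
    and "norm ((1 - of_real lam) * harm h g (z ^ m) + of_real lam * Dop2 h g (z ^ m)) > dist_bdry (harm h g)"
proof -
  have r1: "r ^ m < 1" using assms by (simp add: power_less_one_iff)
  then have ne: "complex_of_real r ^ m \<noteq> 1" by (metis less_irrefl of_real_eq_1_iff of_real_power)
  have "(1 - of_real lam) * (z ^ m / (1 - z ^ m)) + of_real lam * (z ^ m * (1 / (1 - z ^ m)\<^sup>2))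
      = complex_of_real (radius_fun lam (r ^ m))"
    by (simp add: radius_fun_def z_def)
  moreover have "radius_fun lam (r ^ m) > 1 / 2"
    using assms(6) by (simp add: root_eq_radius_fun)
  ultimately have
    "norm ((1 - of_real lam) * (z ^ m / (1 - z ^ m)) + of_real lam * (z ^ m * (1 / (1 - z ^ m)\<^sup>2))) > 1 / 2"
    by (simp only: norm_of_real)
  moreover have "Dop h g (z ^ m) = z ^ m * (1 / (1 - z ^ m)\<^sup>2)" "Dop2 h g (z ^ m) = z ^ m * (1 / (1 - z ^ m)\<^sup>2)"
    "harm h g (z ^ m) = z ^ m / (1 - z ^ m)"
    using ne by (simp_all add: Dop_def Dop2_def harm_def h_def g_def z_def deriv_half_plane_map)
  moreover have "dist_bdry (harm h g) \<le> 1 / 2"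
    unfolding h_def g_def by (rule half_plane_map_stable_convex)
  ultimately show "norm ((1 - of_real lam) * harm h g (z ^ m) + of_real lam * Dop h g (z ^ m)) > dist_bdry (harm h g)"
    and "norm ((1 - of_real lam) * harm h g (z ^ m) + of_real lam * Dop2 h g (z ^ m)) > dist_bdry (harm h g)"
    by simp_all
qed

section \<open>The inequality within the radius and its failure beyond\<close>

text \<open>Both operators are bounded by
  \<open>norm w * (norm (deriv h w) + norm (deriv g w))\<close>, so one estimate through
  \<open>growth\<close> and monotonicity of \<open>radius_fun\<close> covers both.\<close>

lemma (in stable_convex_map) radius_bound:
  assumes lam: "0 \<le> lam" "lam \<le> 1" and w: "norm w \<le> x" and x: "x < 1" "radius_fun lam x \<le> 1 / 2"
  shows "norm ((1 - of_real lam) * harm h g w + of_real lam * Dop h g w) \<le> dist_bdry (harm h g)"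
    and "norm ((1 - of_real lam) * harm h g w + of_real lam * Dop2 h g w) \<le> dist_bdry (harm h g)"
proof -
  have wd: "w \<in> unit_disk" using w x by simp
  have *: "norm ((1 - of_real lam) * harm h g w + of_real lam * D) \<le> dist_bdry (harm h g)"
    if D: "norm D \<le> norm w * (norm (deriv h w) + norm (deriv g w))" for D
  proof -
    have F: "norm (harm h g w) \<le> norm w / (1 - norm w)"
      using norm_triangle_ineq[of "h w" "cnj (g w)"] growth(1)[OF wd] by (simp add: harm_def)
    have D': "norm D \<le> norm w / (1 - norm w)\<^sup>2"
      using D mult_left_mono[OF growth(2)[OF wd], of "norm w"] by simp
    have "norm (1 - complex_of_real lam) = 1 - lam"
      using lam by (metis abs_of_nonneg diff_ge_0_iff_ge norm_of_real of_real_1 of_real_diff)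
    then have "norm ((1 - of_real lam) * harm h g w + of_real lam * D)
        \<le> (1 - lam) * norm (harm h g w) + lam * norm D"
      using norm_triangle_ineq[of "(1 - of_real lam) * harm h g w" "of_real lam * D"] lam
      by (simp add: norm_mult)
    also have "\<dots> \<le> radius_fun lam (norm w)"
      using add_mono[OF mult_left_mono[OF F, of "1 - lam"] mult_left_mono[OF D', of lam]] lam
      by (simp add: radius_fun_def)
    also have "\<dots> \<le> radius_fun lam x"
      using radius_fun_strict_mono[OF lam, of "norm w" x] w x by (cases "norm w = x") auto
    also have "\<dots> \<le> dist_bdry (harm h g)" using x(2) dist_bdry_ge by linarith
    finally show ?thesis .
  qed
  show "norm ((1 - of_real lam) * harm h g w + of_real lam * Dop h g w) \<le> dist_bdry (harm h g)"
    using norm_triangle_ineq4[of "w * deriv h w" "cnj w * cnj (deriv g w)"]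
    by (intro *) (simp add: Dop_def norm_mult ring_distribs)
  show "norm ((1 - of_real lam) * harm h g w + of_real lam * Dop2 h g w) \<le> dist_bdry (harm h g)"
    using norm_triangle_ineq[of "w * deriv h w" "cnj w * cnj (deriv g w)"]
    by (intro *) (simp add: Dop2_def norm_mult ring_distribs)
qed

theorem theorem4p2:
  fixes m :: nat and lam :: real
  assumes "m \<ge> 1" and "0 \<le> lam" and "lam \<le> 1"
  shows "\<exists>r6. r6 \<in> {0<..<1} \<and> root_eq lam m r6 = 0 \<and>
     (\<forall>r\<in>{0<..<1}. root_eq lam m r = 0 \<longrightarrow> r = r6) \<and>
     (\<forall>h g \<omega> z. in_SH0 h g \<and> stable_convex h g \<and> \<omega> \<in> B_class m \<and> norm z \<le> r6 \<longrightarrow>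
        norm ((1 - of_real lam) * harm h g (\<omega> z) + of_real lam * Dop h g (\<omega> z)) \<le> dist_bdry (harm h g) \<and>
        norm ((1 - of_real lam) * harm h g (\<omega> z) + of_real lam * Dop2 h g (\<omega> z)) \<le> dist_bdry (harm h g)) \<and>
     (\<forall>r. r6 < r \<and> r < 1 \<longrightarrow> (\<exists>h g \<omega> z. in_SH0 h g \<and> stable_convex h g \<and> \<omega> \<in> B_class m \<and> norm z = r \<and>
        norm ((1 - of_real lam) * harm h g (\<omega> z) + of_real lam * Dop h g (\<omega> z)) > dist_bdry (harm h g))) \<and>
     (\<forall>r. r6 < r \<and> r < 1 \<longrightarrow> (\<exists>h g \<omega> z. in_SH0 h g \<and> stable_convex h g \<and> \<omega> \<in> B_class m \<and> norm z = r \<and>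
        norm ((1 - of_real lam) * harm h g (\<omega> z) + of_real lam * Dop2 h g (\<omega> z)) > dist_bdry (harm h g)))"
proof -
  obtain r6 where r6: "r6 \<in> {0<..<1}" "root_eq lam m r6 = 0"
      "\<And>r. r \<in> {0<..<1} \<Longrightarrow> root_eq lam m r = 0 \<Longrightarrow> r = r6"
    using root_eq_ex1[OF assms] by blast
  have pow: "r6 ^ m < 1" "radius_fun lam (r6 ^ m) = 1 / 2"
    using r6(1,2) assms(1) by (auto simp: power_less_one_iff root_eq_radius_fun)
  have in_radius: "norm ((1 - of_real lam) * harm h g (\<omega> z) + of_real lam * Dop h g (\<omega> z)) \<le> dist_bdry (harm h g) \<and>
      norm ((1 - of_real lam) * harm h g (\<omega> z) + of_real lam * Dop2 h g (\<omega> z)) \<le> dist_bdry (harm h g)"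
    if H: "in_SH0 h g \<and> stable_convex h g \<and> \<omega> \<in> B_class m \<and> norm z \<le> r6" for h g \<omega> z
  proof -
    interpret stable_convex_map h g using H by unfold_locales auto
    have "norm (\<omega> z) \<le> norm z ^ m" using H r6(1) by (intro B_class_bound) auto
    also have "\<dots> \<le> r6 ^ m" using H by (intro power_mono) auto
    finally show ?thesis using radius_bound[OF assms(2,3) _ pow(1)] pow(2) by simp
  qed
  \<comment> \<open>Strict monotonicity makes the left side positive beyond its root, so a single
    choice of \<open>h\<close>, \<open>g\<close> and \<open>\<omega>\<close>, evaluated at
    \<open>z = r\<close>, violates the inequality for every larger \<open>r\<close>.\<close>
  have exceeds: "root_eq lam m r > 0" if "r6 < r" "r < 1" for r
    using radius_fun_strict_mono[OF assms(2,3), of "r6 ^ m" "r ^ m"] that r6(1) pow assms(1)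
    by (simp add: root_eq_radius_fun power_strict_mono power_less_one_iff)
  let ?h = "\<lambda>z::complex. z / (1 - z)" and ?g = "\<lambda>_::complex. 0 :: complex"
    and ?w = "\<lambda>z::complex. z ^ m"
  have sharp:
    "norm ((1 - of_real lam) * harm ?h ?g (?w (of_real r)) + of_real lam * Dop ?h ?g (?w (of_real r))) > dist_bdry (harm ?h ?g)"
    "norm ((1 - of_real lam) * harm ?h ?g (?w (of_real r)) + of_real lam * Dop2 ?h ?g (?w (of_real r))) > dist_bdry (harm ?h ?g)"
    "norm (complex_of_real r) = r"
    if "r6 < r" "r < 1" for r
    using half_plane_map_exceeds[OF assms(2,3) _ _ assms(1) exceeds[OF that]] that r6(1) by auto
  show ?thesis
  proof (intro exI[of _ r6] conjI)
    show "\<forall>r. r6 < r \<and> r < 1 \<longrightarrow> (\<exists>h g \<omega> z. in_SH0 h g \<and> stable_convex h g \<and> \<omega> \<in> B_class m \<and> norm z = r \<and>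
        norm ((1 - of_real lam) * harm h g (\<omega> z) + of_real lam * Dop h g (\<omega> z)) > dist_bdry (harm h g))"
      using half_plane_map_stable_convex(1,2) power_in_B_class sharp(1,3) by meson
    show "\<forall>r. r6 < r \<and> r < 1 \<longrightarrow> (\<exists>h g \<omega> z. in_SH0 h g \<and> stable_convex h g \<and> \<omega> \<in> B_class m \<and> norm z = r \<and>
        norm ((1 - of_real lam) * harm h g (\<omega> z) + of_real lam * Dop2 h g (\<omega> z)) > dist_bdry (harm h g))"
      using half_plane_map_stable_convex(1,2) power_in_B_class sharp(2,3) by meson
    show "\<forall>h g \<omega> z. in_SH0 h g \<and> stable_convex h g \<and> \<omega> \<in> B_class m \<and> norm z \<le> r6 \<longrightarrow>
        norm ((1 - of_real lam) * harm h g (\<omega> z) + of_real lam * Dop h g (\<omega> z)) \<le> dist_bdry (harm h g) \<and>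
        norm ((1 - of_real lam) * harm h g (\<omega> z) + of_real lam * Dop2 h g (\<omega> z)) \<le> dist_bdry (harm h g)"
      by (intro allI impI) (rule in_radius)
    show "\<forall>r\<in>{0<..<1}. root_eq lam m r = 0 \<longrightarrow> r = r6"
      using r6(3) by blast
  qed (rule r6)+
qed

end
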